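(* Let $G$ be a Hausdorff topological group and let $S\subseteq G$ be a subsemigroup of $G$ which is open in $G$ and precompact in $G$. Then $S$ is a closed subgroup of $G$.
   Context: A subsemigroup of a group $G$ is a nonempty subset $S\subseteq G$ with $SS\subseteq S$. A subset $A$ of a topological group $G$ with neutral element $e$ is precompact in $G$ if for every neighborhood $V$ of $e$ there exists a finite set $K\subseteq G$ such that $A\subseteq KV$ and $A\subseteq VK$. *)

theory Defs
  imports "HOL-Analysis.Analysis" "HOL-Algebra.Coset"
begin

locale topological_group = group G for G (structure) +
  fixes T :: "'a topology"
  assumes topspace_eq_carrier: "topspace T = carrier G"
    and continuous_mult: "continuous_map (prod_topology T T) T (\<lambda>(x, y). x \<otimes> y)"
    and continuous_inv: "continuous_map T T (\<lambda>x. inv x)"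

definition subsemigroup :: "'a set \<Rightarrow> ('a, 'b) monoid_scheme \<Rightarrow> bool"
  where "subsemigroup S G \<longleftrightarrow>
    S \<subseteq> carrier G \<and> S \<noteq> {} \<and> S <#>\<^bsub>G\<^esub> S \<subseteq> S"

text \<open>Neighborhoods are not required to be open.\<close>

definition neighborhood_in :: "'a topology \<Rightarrow> 'a \<Rightarrow> 'a set \<Rightarrow> bool"
  where "neighborhood_in T x V \<longleftrightarrow>
    V \<subseteq> topspace T \<and> (\<exists>U. openin T U \<and> x \<in> U \<and> U \<subseteq> V)"

definition precompact_in :: "('a, 'b) monoid_scheme \<Rightarrow> 'a topology \<Rightarrow> 'a set \<Rightarrow> bool"
  where "precompact_in G T A \<longleftrightarrow>
    A \<subseteq> carrier G \<and>
    (\<forall>V. neighborhood_in T \<one>\<^bsub>G\<^esub> V \<longrightarrow>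
      (\<exists>K. finite K \<and> K \<subseteq> carrier G \<and> A \<subseteq> K <#>\<^bsub>G\<^esub> V \<and> A \<subseteq> V <#>\<^bsub>G\<^esub> K))"

end

theory Submission
  imports Defs
begin

text \<open>
  For \<open>x \<in> S\<close>, precompactness and the pigeonhole principle make two even powers of \<open>x\<close> so close
  that \<open>x x\<^sup>-\<^sup>j \<in> S\<close> for some even \<open>j \<ge> 2\<close>, because \<open>S\<close> is a neighborhood of \<open>x\<close>. Multiplying by
  \<open>x\<^sup>j\<^sup>-\<^sup>2\<close> gives \<open>x\<^sup>-\<^sup>1 \<in> S\<close>. Hence \<open>S\<close> is an open subgroup, and therefore closed.
\<close>

lemma subsemigroup_mult:
  assumes "subsemigroup S G" "a \<in> S" "b \<in> S"
  shows "a \<otimes>\<^bsub>G\<^esub> b \<in> S"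
  using assms unfolding subsemigroup_def set_mult_def by blast

text \<open>Stated for \<open>Suc n\<close> because a subsemigroup need not contain
  \<open>\<one> = x [^] 0\<close>.\<close>

lemma (in group) subsemigroup_pow:
  assumes "subsemigroup S G" "x \<in> S"
  shows "x [^] Suc n \<in> S"
proof (induction n)
  case 0
  then show ?case using assms by (auto simp: subsemigroup_def)
next
  case (Suc n)
  then show ?case using subsemigroup_mult[OF assms(1) Suc assms(2)] by simp
qed

context topological_group
begin

lemma continuous_map_mult:
  assumes "continuous_map X T f" "continuous_map X T g"
  shows "continuous_map X T (\<lambda>x. f x \<otimes> g x)"
proof -
  have "continuous_map X (prod_topology T T) (\<lambda>x. (f x, g x))"
    using assms by (simp add: continuous_map_pairedI)
  from continuous_map_compose[OF this continuous_mult] show ?thesis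
    by (simp add: o_def)
qed

lemma continuous_map_inv:
  assumes "continuous_map X T f"
  shows "continuous_map X T (\<lambda>x. inv (f x))"
  using continuous_map_compose[OF assms continuous_inv] by (simp add: o_def)

text \<open>The map \<open>(u, v) \<mapsto> x \<otimes> (inv u \<otimes> v)\<close> is continuous
  and sends \<open>(\<one>, \<one>)\<close> to \<open>x\<close>. The quotient
  \<open>inv u \<otimes> v\<close> is the one to control because it is unchanged when
  \<open>u\<close> and \<open>v\<close> are both multiplied on the left by the same
  \<open>k\<close>.\<close>

lemma open_nhd_left_division:
  assumes "openin T S" "x \<in> S"
  obtains V where "openin T V" "\<one> \<in> V"
    "\<And>u v. u \<in> V \<Longrightarrow> v \<in> V \<Longrightarrow> x \<otimes> (inv u \<otimes> v) \<in> S"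
proof -
  have x: "x \<in> carrier G"
    using assms openin_subset topspace_eq_carrier by blast
  let ?f = "\<lambda>p. x \<otimes> (inv (fst p) \<otimes> snd p)"
  define P where "P = {p \<in> topspace (prod_topology T T). ?f p \<in> S}"
  have "continuous_map (prod_topology T T) T ?f"
    using x topspace_eq_carrier
    by (intro continuous_map_mult continuous_map_inv continuous_map_fst continuous_map_snd) simp
  then have P_open: "openin (prod_topology T T) P"
    unfolding P_def using assms(1) openin_continuous_map_preimage by blast
  have one_P: "(\<one>, \<one>) \<in> P"
    using assms(2) x by (simp add: P_def topspace_eq_carrier)
  obtain A B where AB: "openin T A" "openin T B" "\<one> \<in> A" "\<one> \<in> B" "A \<times> B \<subseteq> P"
    using P_open[unfolded openin_prod_topology_alt, rule_format, OF one_P] by (elim exE conjE)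
  show thesis
  proof (rule that)
    \<comment> \<open>Intersecting the sides of the rectangle \<open>A \<times> B\<close> gives a
      square inside \<open>P\<close>.\<close>
    show "openin T (A \<inter> B)" "\<one> \<in> A \<inter> B"
      using AB by auto
    show "x \<otimes> (inv u \<otimes> v) \<in> S" if "u \<in> A \<inter> B" "v \<in> A \<inter> B" for u v
    proof -
      have "(u, v) \<in> P"
        using that AB(5) by blast
      then show ?thesis by (simp add: P_def)
    qed
  qed
qed

lemma open_precompact_subsemigroup_inv:
  assumes S: "subsemigroup S G" "openin T S" "precompact_in G T S" and xS: "x \<in> S"
  shows "inv x \<in> S"
proof -
  have x: "x \<in> carrier G"
    using S xS by (auto simp: subsemigroup_def)
  obtain V where V: "openin T V" "\<one> \<in> V"
    "\<And>u v. u \<in> V \<Longrightarrow> v \<in> V \<Longrightarrow> x \<otimes> (inv u \<otimes> v) \<in> S"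
    using open_nhd_left_division[OF S(2) xS] by blast
  have Vc: "V \<subseteq> carrier G"
    using V(1) openin_subset topspace_eq_carrier by blast
  then have "neighborhood_in T \<one> V"
    using V unfolding neighborhood_in_def topspace_eq_carrier by blast
  then obtain K where K: "finite K" "K \<subseteq> carrier G" "S \<subseteq> K <#> V"
    using S(3) unfolding precompact_in_def by blast
  \<comment> \<open>Only the exponents \<open>2 * n + 2\<close> are used: two different ones differ
    by at least 2. A difference of 1 would only yield \<open>x \<otimes> inv x = \<one>\<close> in
    the end.\<close>
  have "\<exists>k\<in>K. \<exists>v\<in>V. x [^] Suc (2 * n + 1) = k \<otimes> v" for n
    using subsemigroup_pow[OF S(1) xS, of "2 * n + 1"] K(3) unfolding set_mult_def by blast
  then obtain k v where kv: "\<And>n. k n \<in> K" "\<And>n. v n \<in> V"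
    "\<And>n. x [^] Suc (2 * n + 1) = k n \<otimes> v n"
    by metis
  have "\<not> inj k"
    using finite_subset[of "range k" K] K(1) kv(1) finite_imageD[of k UNIV] by auto
  then obtain m n where mn: "m < n" "k m = k n"
    by (metis injI linorder_neqE_nat)
  \<comment> \<open>The gap between the two exponents is \<open>l + 2\<close>; as
    \<open>m < n\<close>, no subtraction is truncated.\<close>
  define l where "l = 2 * (n - m) - 2"
  have kc: "k n \<in> carrier G" and vc: "\<And>i. v i \<in> carrier G"
    using kv K(2) Vc by auto
  have exponent: "Suc (2 * n + 1) = Suc (2 * m + 1) + Suc (Suc l)"
    using mn(1) by (simp add: l_def)
  have "k n \<otimes> v n = x [^] Suc (2 * m + 1) \<otimes> x [^] Suc (Suc l)"
    unfolding nat_pow_mult[OF x] exponent[symmetric] by (rule kv(3)[symmetric])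
  then have "k n \<otimes> v n = k n \<otimes> v m \<otimes> x [^] Suc (Suc l)"
    unfolding kv(3)[of m] mn(2) .
  then have "v n = v m \<otimes> x [^] Suc (Suc l)"
    using kc vc x by (simp add: m_assoc del: nat_pow_Suc)
  \<comment> \<open>The factor with the larger exponent is the one inverted, so the quotient is a
    negative power of \<open>x\<close>.\<close>
  then have "inv (v n) \<otimes> v m = inv (x [^] Suc (Suc l))"
    using vc x by (simp add: inv_mult_group m_assoc del: nat_pow_Suc)
  moreover have "x \<otimes> inv (x [^] Suc (Suc l)) = inv (x [^] Suc l)"
    using x nat_pow_Suc[of x "Suc l"]
    by (simp add: inv_mult_group m_assoc[symmetric] del: nat_pow_Suc)
  ultimately have inv_pow: "inv (x [^] Suc l) \<in> S"
    using V(3)[OF kv(2)[of n] kv(2)[of m]] by simp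
  \<comment> \<open>It remains to multiply by \<open>x [^] l\<close>. The case \<open>l = 0\<close>
    is separate since \<open>\<one> \<in> S\<close> is not yet known.\<close>
  show ?thesis
  proof (cases l)
    case 0
    then show ?thesis using inv_pow x by simp
  next
    case (Suc i)
    have "inv (x [^] Suc l) \<otimes> x [^] l = inv x"
      using x by (simp add: inv_mult_group m_assoc)
    then show ?thesis
      using subsemigroup_mult[OF S(1) inv_pow subsemigroup_pow[OF S(1) xS, of i]] Suc by simp
  qed
qed

text \<open>The complement is a union of right cosets of \<open>H\<close>, each open as a translate
  of \<open>H\<close>.\<close>

lemma open_subgroup_closed:
  assumes "subgroup H G" "openin T H"
  shows "closedin T H"
proof -
  have "\<exists>U. openin T U \<and> z \<in> U \<and> U \<subseteq> topspace T - H" if z: "z \<in> topspace T - H" for z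
  proof (intro exI conjI)
    \<comment> \<open>This is the coset \<open>H #> z\<close>, written as a preimage of
      \<open>H\<close> so that continuity makes it open.\<close>
    let ?U = "{w \<in> topspace T. w \<otimes> inv z \<in> H}"
    have zc: "z \<in> carrier G" "z \<notin> H"
      using z topspace_eq_carrier by auto
    have "continuous_map T T (\<lambda>w. w \<otimes> inv z)"
      using zc topspace_eq_carrier by (intro continuous_map_mult) auto
    then show "openin T ?U"
      using assms(2) openin_continuous_map_preimage by blast
    show "z \<in> ?U"
      using zc topspace_eq_carrier subgroup.one_closed[OF assms(1)] by simp
    have "w \<notin> H" if w: "w \<in> ?U" for w
    proof
      assume "w \<in> H"
      \<comment> \<open>This element equals \<open>z\<close>, which lies outside
        \<open>H\<close>.\<close>
      then have "inv (inv w \<otimes> (w \<otimes> inv z)) \<in> H"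
        using w assms(1) by (auto intro!: subgroup.m_closed subgroup.m_inv_closed)
      then show False
        using w zc topspace_eq_carrier by (simp add: m_assoc[symmetric])
    qed
    then show "?U \<subseteq> topspace T - H" by blast
  qed
  then have "openin T (topspace T - H)"
    by (subst openin_subopen) blast
  then show ?thesis
    using assms(2) openin_subset unfolding closedin_def by blast
qed

end

theorem theorem2p10:
  fixes G :: "('a, 'b) monoid_scheme" and T :: "'a topology" and S :: "'a set"
  assumes "topological_group G T"
    and "Hausdorff_space T"
    and "subsemigroup S G"
    and "openin T S"
    and "precompact_in G T S"
  shows "subgroup S G \<and> closedin T S"
proof -
  interpret topological_group G T by fact
  have "subgroup S G"
    using assms(3) subsemigroup_mult[OF assms(3)]
      open_precompact_subsemigroup_inv[OF assms(3-5)]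
    by (intro subgroupI) (auto simp: subsemigroup_def)
  then show ?thesis
    using open_subgroup_closed[OF _ assms(4)] by blast
qed

end
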